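(* The self-embedding monoids of the following structures have automatic homeomorphicity: the structure without structure $(\mathbb N;=)$; the random tournament; the random graph; the random directed graph; the random $k$-uniform hypergraph, for every $k\ge 2$.
   Context: The random tournament, random graph, random directed graph and random $k$-uniform hypergraph are the Fraïssé limits (the unique countable homogeneous structures whose finite induced substructures are, up to isomorphism, exactly the members of the class) of, respectively, the class of all finite tournaments, all finite undirected loopless graphs, all finite loopless directed graphs (a set with an irreflexive binary relation), and all finite $k$-uniform hypergraphs (a set with a totally symmetric $k$-ary relation consisting of tuples with pairwise distinct entries). A self-embedding of a structure is an injective map from the structure to itself preserving and reflecting all relations. $\mathbf O^{(1)}$ is the monoid of all functions from a countably infinite set to itself with the topology of pointwise convergence (domain discrete). The self-embedding monoids above are closed submonoids of $\mathbf O^{(1)}$ (on the respective domains). A closed submonoid $M$ of $\mathbf O^{(1)}$ has automatic homeomorphicity if every monoid isomorphism between $M$ and a closed submonoid of $\mathbf O^{(1)}$ is a homeomorphism. *)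

theory Defs
  imports
    "HOL-Analysis.Analysis"
    "HOL-Algebra.Group"
    "HOL-Library.Countable"
    "HOL-Library.Infinite_Typeclass"
begin

section \<open>Relational structures with one relation\<close>

text \<open>
  A structure is a carrier set \<open>A\<close> together with one finitary relation, a set \<open>R\<close> of lists
  over \<open>A\<close>. No arity is fixed here; the classes below fix the length of the lists.
\<close>

definition is_structure :: "'a set \<Rightarrow> 'a list set \<Rightarrow> bool" where
  "is_structure A R \<longleftrightarrow> R \<subseteq> lists A"

definition induced :: "'a list set \<Rightarrow> 'a set \<Rightarrow> 'a list set" where
  "induced R X = R \<inter> lists X"

definition embedding :: "'a set \<Rightarrow> 'a list set \<Rightarrow> 'b set \<Rightarrow> 'b list set \<Rightarrow> ('a \<Rightarrow> 'b) \<Rightarrow> bool" where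
  "embedding A R B S f \<longleftrightarrow>
     f \<in> A \<rightarrow> B \<and> inj_on f A \<and> (\<forall>xs\<in>lists A. map f xs \<in> S \<longleftrightarrow> xs \<in> R)"

definition isomorphism :: "'a set \<Rightarrow> 'a list set \<Rightarrow> 'b set \<Rightarrow> 'b list set \<Rightarrow> ('a \<Rightarrow> 'b) \<Rightarrow> bool" where
  "isomorphism A R B S f \<longleftrightarrow> embedding A R B S f \<and> f ` A = B"

definition homogeneous :: "'a set \<Rightarrow> 'a list set \<Rightarrow> bool" where
  "homogeneous A R \<longleftrightarrow>
     (\<forall>X Y f. X \<subseteq> A \<longrightarrow> Y \<subseteq> A \<longrightarrow> finite X \<longrightarrow> isomorphism X (induced R X) Y (induced R Y) f \<longrightarrow>
        (\<exists>g. isomorphism A R A R g \<and> (\<forall>x\<in>X. g x = f x)))"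

text \<open>
  The members of the class \<open>K\<close> live on subsets of the type of the limit. As the type will be
  infinite, this captures all finite structures up to isomorphism, and all classes used below are
  closed under isomorphism.
\<close>

definition fraisse_limit ::
  "('a set \<Rightarrow> 'a list set \<Rightarrow> bool) \<Rightarrow> 'a set \<Rightarrow> 'a list set \<Rightarrow> bool" where
  "fraisse_limit K A R \<longleftrightarrow>
     countable A \<and> is_structure A R \<and> homogeneous A R \<and>
     (\<forall>X. X \<subseteq> A \<longrightarrow> finite X \<longrightarrow> K X (induced R X)) \<and>
     (\<forall>B S. finite B \<longrightarrow> K B S \<longrightarrow> (\<exists>X f. X \<subseteq> A \<and> isomorphism B S X (induced R X) f))"

section \<open>The classes of finite structures\<close>

definition pairs :: "'a rel \<Rightarrow> 'a list set" where
  "pairs E = {[x, y] |x y. (x, y) \<in> E}"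

definition finite_tournament :: "'a set \<Rightarrow> 'a list set \<Rightarrow> bool" where
  "finite_tournament A S \<longleftrightarrow>
     finite A \<and> (\<exists>E. E \<subseteq> A \<times> A \<and> asym E \<and> total_on A E \<and> S = pairs E)"

definition finite_graph :: "'a set \<Rightarrow> 'a list set \<Rightarrow> bool" where
  "finite_graph A S \<longleftrightarrow>
     finite A \<and> (\<exists>E. E \<subseteq> A \<times> A \<and> irrefl E \<and> sym E \<and> S = pairs E)"

definition finite_digraph :: "'a set \<Rightarrow> 'a list set \<Rightarrow> bool" where
  "finite_digraph A S \<longleftrightarrow>
     finite A \<and> (\<exists>E. E \<subseteq> A \<times> A \<and> irrefl E \<and> S = pairs E)"

definition finite_hypergraph :: "nat \<Rightarrow> 'a set \<Rightarrow> 'a list set \<Rightarrow> bool" where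
  "finite_hypergraph k A S \<longleftrightarrow>
     finite A \<and> S \<subseteq> lists A \<and> (\<forall>xs\<in>S. length xs = k \<and> distinct xs) \<and>
     (\<forall>xs\<in>S. \<forall>ys. mset ys = mset xs \<longrightarrow> ys \<in> S)"

section \<open>Closed transformation monoids\<close>

definition full_monoid :: "('a \<Rightarrow> 'a) monoid" where
  "full_monoid = \<lparr>carrier = UNIV, mult = (\<circ>), one = id\<rparr>"

definition pointwise_topology :: "('a \<Rightarrow> 'a) topology" where
  "pointwise_topology = product_topology (\<lambda>_. discrete_topology UNIV) UNIV"

definition closed_submonoid :: "('a \<Rightarrow> 'a) set \<Rightarrow> bool" where
  "closed_submonoid M \<longleftrightarrow> submonoid M full_monoid \<and> closedin pointwise_topology M"

text \<open>
  Elements of \<^term>\<open>iso G H\<close> are only required to be bijective and multiplicative; they preserve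
  the identity automatically, being surjective.
\<close>

definition automatic_homeomorphicity :: "('a::{countable,infinite} \<Rightarrow> 'a) set \<Rightarrow> bool" where
  "automatic_homeomorphicity M \<longleftrightarrow>
     closed_submonoid M \<and>
     (\<forall>(N :: ('a \<Rightarrow> 'a) set) \<phi>. closed_submonoid N \<longrightarrow>
        \<phi> \<in> iso (full_monoid\<lparr>carrier := M\<rparr>) (full_monoid\<lparr>carrier := N\<rparr>) \<longrightarrow>
        homeomorphic_map (subtopology pointwise_topology M) (subtopology pointwise_topology N) \<phi>)"

definition self_embeddings :: "'a list set \<Rightarrow> ('a \<Rightarrow> 'a) set" where
  "self_embeddings R = {f. embedding UNIV R UNIV R f}"

end

theory Submission
  imports Defs
begin

text \<open>
  Let \<open>M\<close> be the self-embedding monoid of a countable homogeneous structure, \<open>G\<close> the group of its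
  units, that is, of the automorphisms, and \<open>\<phi>\<close> a monoid isomorphism onto a closed monoid \<open>N\<close>. The
  proof rests on two properties of \<open>M\<close>: the units are dense (this is homogeneity), and for every
  set \<open>C\<close> of points, finite or not, there are \<open>p\<close> and \<open>q\<close> in \<open>M\<close> that agree on \<open>C\<close> and send the
  complement of \<open>C\<close> to disjoint sets (two copies of the structure glued along \<open>C\<close> embed into it).

  The inverse of \<open>\<phi>\<close> is continuous, because the sets \<open>{f. f a = b}\<close> are definable by
  inequations. Gluing along the complement of \<open>b\<close> gives \<open>p\<close> and \<open>q\<close> which differ at \<open>b\<close> only, so that
  \<open>p \<circ> h \<noteq> q \<circ> h\<close> says that \<open>b\<close> lies in the range of \<open>h\<close>. Gluing along \<open>a\<close> gives \<open>e\<close> and \<open>e'\<close> whose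
  ranges meet in \<open>a\<close> only, so that \<open>f a = b\<close> iff \<open>b\<close> lies in the ranges of both \<open>f \<circ> e\<close> and \<open>f \<circ> e'\<close>.
  An inequation between compositions is an open condition in every monoid of functions, in
  particular after translation by \<open>\<phi>\<close>.

  Continuity of \<open>\<phi>\<close> on \<open>G\<close> is then an open mapping argument. A stabiliser in \<open>\<phi> ` G\<close> of finitely
  many points has countable index; as \<open>G\<close> is Polish, Baire's theorem makes its preimage dense in the
  pointwise stabiliser of some finite set. An element \<open>g\<close> of the latter is approximated by products
  \<open>u 0 \<circ> \<dots> \<circ> u n\<close> of units whose images fix more and more points. The images of the products
  converge, their limit lies in the closed set \<open>N\<close>, and it must be \<open>\<phi> g\<close> by continuity of the inverse.
  So \<open>\<phi> g\<close> fixes the points that all factors fix. The same device, with arbitrary elements of \<open>M\<close> as limits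
  of units, carries continuity over from \<open>G\<close> to \<open>M\<close>.

  For the Fraisse limits, two copies glued along \<open>C\<close> form a countable structure all of whose finite
  parts belong to the class: for graphs, directed graphs and hypergraphs no tuple relates the two
  copies, and for tournaments the first copy beats the second. Homogeneity and universality for
  finite structures then give an embedding of the glued structure.
\<close>

(* From here on, inv is the inverse of a function rather than of a group element. *)
unbundle no m_inv_syntax

section \<open>The topology of pointwise convergence\<close>

lemma topspace_pointwise [simp]: "topspace pointwise_topology = UNIV"
  by (simp add: pointwise_topology_def PiE_UNIV_domain)

lemma openin_pointwise_iff:
  fixes U :: "('a \<Rightarrow> 'a) set"
  shows "openin pointwise_topology U \<longleftrightarrow>
    (\<forall>f\<in>U. \<exists>F. finite F \<and> {g. \<forall>x\<in>F. g x = f x} \<subseteq> U)" (is "_ \<longleftrightarrow> ?R")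
proof
  assume L: "openin pointwise_topology U"
  show ?R
  proof
    fix f assume "f \<in> U"
    from L[unfolded pointwise_topology_def openin_product_topology_alt, rule_format, OF this]
    obtain V where "finite {i \<in> UNIV. V i \<noteq> topspace (discrete_topology (UNIV :: 'a set))}"
      and "f \<in> Pi\<^sub>E UNIV V" and sub: "Pi\<^sub>E UNIV V \<subseteq> U"
      by blast
    then have fin: "finite {i. V i \<noteq> UNIV}" and f: "\<And>i. f i \<in> V i"
      by (auto simp: PiE_UNIV_domain)
    have "g \<in> U" if g: "\<forall>x\<in>{i. V i \<noteq> UNIV}. g x = f x" for g
    proof -
      have "g i \<in> V i" for i using g f[of i] by (cases "V i = UNIV") auto
      then show ?thesis using sub by (auto simp: PiE_UNIV_domain)
    qed
    then show "\<exists>F. finite F \<and> {g. \<forall>x\<in>F. g x = f x} \<subseteq> U" using fin by blast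
  qed
next
  assume R: ?R
  show "openin pointwise_topology U"
    unfolding pointwise_topology_def openin_product_topology_alt
  proof
    fix f assume "f \<in> U"
    then obtain F where F: "finite F" "{g. \<forall>x\<in>F. g x = f x} \<subseteq> U" using R by blast
    have "finite {i \<in> UNIV. (if i \<in> F then {f i} else UNIV) \<noteq> topspace (discrete_topology UNIV)}"
      by (rule finite_subset[OF _ F(1)]) auto
    moreover have "Pi\<^sub>E UNIV (\<lambda>i. if i \<in> F then {f i} else UNIV) \<subseteq> U"
    proof
      fix g assume "g \<in> Pi\<^sub>E UNIV (\<lambda>i. if i \<in> F then {f i} else UNIV)"
      then have "g i \<in> (if i \<in> F then {f i} else UNIV)" for i by (simp add: PiE_UNIV_domain Pi_iff)
      then have "\<forall>i\<in>F. g i = f i" by (metis singletonD)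
      then show "g \<in> U" using F(2) by blast
    qed
    ultimately show "\<exists>V. finite {i \<in> UNIV. V i \<noteq> topspace (discrete_topology UNIV)} \<and>
       (\<forall>i\<in>UNIV. openin (discrete_topology UNIV) (V i)) \<and> f \<in> Pi\<^sub>E UNIV V \<and> Pi\<^sub>E UNIV V \<subseteq> U"
      by (intro exI[of _ "\<lambda>i. if i \<in> F then {f i} else UNIV"]) (auto simp: PiE_UNIV_domain)
  qed
qed

lemma openin_cylinder:
  "finite F \<Longrightarrow> openin pointwise_topology {g. \<forall>x\<in>F. g x = f x}"
  unfolding openin_pointwise_iff by (intro ballI exI[of _ F]) simp

lemma closedin_pointwise_iff:
  fixes M :: "('a \<Rightarrow> 'a) set"
  shows "closedin pointwise_topology M \<longleftrightarrow>
    (\<forall>f. (\<forall>F. finite F \<longrightarrow> (\<exists>g\<in>M. \<forall>x\<in>F. g x = f x)) \<longrightarrow> f \<in> M)"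
proof -
  have "closedin pointwise_topology M \<longleftrightarrow>
    (\<forall>f. f \<notin> M \<longrightarrow> (\<exists>F. finite F \<and> {g. \<forall>x\<in>F. g x = f x} \<subseteq> - M))"
    by (simp add: closedin_def openin_pointwise_iff Ball_def flip: Compl_eq_Diff_UNIV)
  also have "\<dots> \<longleftrightarrow> (\<forall>f. f \<notin> M \<longrightarrow> \<not> (\<forall>F. finite F \<longrightarrow> (\<exists>g\<in>M. \<forall>x\<in>F. g x = f x)))"
    by (intro all_cong1 imp_cong refl) (simp add: subset_eq Bex_def, metis)
  finally show ?thesis by metis
qed

lemma continuous_map_pointwise:
  fixes \<phi> :: "('a \<Rightarrow> 'a) \<Rightarrow> ('b \<Rightarrow> 'b)"
  assumes img: "\<And>f. f \<in> M \<Longrightarrow> \<phi> f \<in> N"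
    and loc: "\<And>f x. f \<in> M \<Longrightarrow>
      \<exists>F. finite F \<and> (\<forall>g\<in>M. (\<forall>y\<in>F. g y = f y) \<longrightarrow> \<phi> g x = \<phi> f x)"
  shows "continuous_map (subtopology pointwise_topology M) (subtopology pointwise_topology N) \<phi>"
proof -
  have "continuous_map (subtopology pointwise_topology M) (discrete_topology UNIV) (\<lambda>f. \<phi> f x)" for x
    unfolding continuous_map_def
  proof (intro conjI allI impI)
    fix U :: "'b set"
    let ?V = "{f \<in> topspace (subtopology pointwise_topology M). \<phi> f x \<in> U}"
    define P where "P f F \<longleftrightarrow> f \<in> M \<and> \<phi> f x \<in> U \<and> finite F \<and>
        (\<forall>g\<in>M. (\<forall>y\<in>F. g y = f y) \<longrightarrow> \<phi> g x = \<phi> f x)" for f F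
    define T where "T = {h. \<exists>f F. P f F \<and> (\<forall>y\<in>F. h y = f y)}"
    have "openin pointwise_topology T"
      unfolding openin_pointwise_iff
    proof
      fix h assume "h \<in> T"
      then obtain f F where f: "P f F" "\<forall>y\<in>F. h y = f y" by (auto simp: T_def)
      have "{g. \<forall>y\<in>F. g y = h y} \<subseteq> T" unfolding T_def using f by fastforce
      moreover have "finite F" using f by (simp add: P_def)
      ultimately show "\<exists>F. finite F \<and> {g. \<forall>y\<in>F. g y = h y} \<subseteq> T" by blast
    qed
    moreover have "?V = T \<inter> M"
    proof
      show "?V \<subseteq> T \<inter> M"
      proof
        fix f assume "f \<in> ?V"
        then have f: "f \<in> M" "\<phi> f x \<in> U" by auto
        then obtain F where "P f F" using loc[of f x] unfolding P_def by blast
        then show "f \<in> T \<inter> M" unfolding T_def using f by blast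
      qed
      show "T \<inter> M \<subseteq> ?V"
      proof
        fix h assume h: "h \<in> T \<inter> M"
        then obtain f F where f: "P f F" "\<forall>y\<in>F. h y = f y" by (auto simp: T_def)
        then have "\<phi> h x = \<phi> f x" "\<phi> f x \<in> U" using h unfolding P_def by blast+
        then show "h \<in> ?V" using h by simp
      qed
    qed
    ultimately show "openin (subtopology pointwise_topology M) ?V"
      by (auto simp: openin_subtopology)
  qed auto
  then have "continuous_map (subtopology pointwise_topology M) pointwise_topology \<phi>"
    unfolding pointwise_topology_def[where 'a='b] continuous_map_componentwise_UNIV by blast
  then show ?thesis
    by (rule continuous_map_into_subtopology) (auto simp: img)
qed

lemma completely_metrizable_pointwise:
  "completely_metrizable_space (pointwise_topology :: ('a::countable \<Rightarrow> 'a) topology)"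
  unfolding pointwise_topology_def completely_metrizable_space_product_topology
  by (auto simp: completely_metrizable_space_discrete_topology)

text \<open>
  A limit of permutations need not be onto, so the units need not form a closed set of functions. Being a \<open>G\<^sub>\<delta>\<close> set is enough for Baire's theorem.
\<close>

lemma gdelta_surjections: "gdelta_in pointwise_topology {f :: 'a::countable \<Rightarrow> 'a. surj f}"
proof -
  have "openin pointwise_topology {f :: 'a \<Rightarrow> 'a. \<exists>a. f a = b}" for b
    unfolding openin_pointwise_iff
  proof clarify
    fix f :: "'a \<Rightarrow> 'a" and a
    show "\<exists>F. finite F \<and> {g. \<forall>x\<in>F. g x = f x} \<subseteq> {g. \<exists>c. g c = f a}"
      by (intro exI[of _ "{a}"]) auto
  qed
  then have "gdelta_in pointwise_topology (\<Inter>b. {f :: 'a \<Rightarrow> 'a. \<exists>a. f a = b})"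
    by (intro gdelta_in_Inter) (auto intro: open_imp_gdelta_in)
  moreover have "(\<Inter>b. {f :: 'a \<Rightarrow> 'a. \<exists>a. f a = b}) = {f. surj f}"
  proof -
    have "surj f \<longleftrightarrow> (\<forall>b. \<exists>a. f a = b)" for f :: "'a \<Rightarrow> 'a"
      by (metis surj_def)
    then show ?thesis by auto
  qed
  ultimately show ?thesis by simp
qed

section \<open>Closed transformation monoids\<close>

lemma closed_submonoid_id: "closed_submonoid M \<Longrightarrow> id \<in> M"
  and closed_submonoid_comp: "closed_submonoid M \<Longrightarrow> f \<in> M \<Longrightarrow> g \<in> M \<Longrightarrow> f \<circ> g \<in> M"
  unfolding closed_submonoid_def submonoid_def full_monoid_def by auto

lemma closed_submonoid_limit:
  assumes "closed_submonoid M" and "\<And>F. finite F \<Longrightarrow> \<exists>g\<in>M. \<forall>x\<in>F. g x = f x"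
  shows "f \<in> M"
  using assms unfolding closed_submonoid_def closedin_pointwise_iff by blast

text \<open>
  An increasing sequence of finite sets that exhausts a countable type. A sequence of functions
  converges as soon as its \<open>n\<close>-th member is correct on \<open>initial n\<close>.
\<close>

definition initial :: "nat \<Rightarrow> 'a::countable set" where
  "initial n = {x. to_nat x < n}"

lemma finite_initial [simp]: "finite (initial n)"
  unfolding initial_def
  by (rule finite_imageD[OF finite_subset[of _ "{..<n}"]]) auto

lemma initial_mono: "m \<le> n \<Longrightarrow> initial m \<subseteq> initial n"
  by (auto simp: initial_def)

lemma finite_subset_initial: "finite F \<Longrightarrow> \<exists>n. F \<subseteq> initial n"
proof (induction F rule: finite_induct)
  case (insert x F)
  then obtain n where "F \<subseteq> initial n" by blast
  then have "insert x F \<subseteq> initial (max n (Suc (to_nat x)))" by (auto simp: initial_def)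
  then show ?case by blast
qed simp

section \<open>Monoids with dense units and self-amalgams\<close>

text \<open>
  The properties of a self-embedding monoid from which automatic homeomorphicity follows. The last
  one abstracts two copies of a structure glued along an arbitrary subset; it is used for
  singletons and for complements of singletons.
\<close>

locale amalgamating_monoid =
  fixes M :: "('a::countable \<Rightarrow> 'a) set"
  assumes closed: "closed_submonoid M"
    and injective: "f \<in> M \<Longrightarrow> inj f"
    and unit: "g \<in> M \<Longrightarrow> surj g \<Longrightarrow> inv g \<in> M"
    and units_dense: "f \<in> M \<Longrightarrow> finite F \<Longrightarrow> \<exists>g\<in>M. surj g \<and> (\<forall>x\<in>F. g x = f x)"
    and amalgam: "\<exists>p\<in>M. \<exists>q\<in>M. (\<forall>x\<in>C. p x = q x) \<and> p ` (- C) \<inter> q ` (- C) = {}"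
begin

lemma id_mem: "id \<in> M"
  using closed by (rule closed_submonoid_id)

lemma comp_mem: "f \<in> M \<Longrightarrow> g \<in> M \<Longrightarrow> f \<circ> g \<in> M"
  using closed by (rule closed_submonoid_comp)

text \<open>
  Such a pair detects whether \<open>b\<close> is in the range of a function \<open>h\<close>: exactly then \<open>p \<circ> h \<noteq> q \<circ> h\<close>.
\<close>

lemma separating_pair:
  obtains p q where "p \<in> M" "q \<in> M" "\<And>y. p y = q y \<longleftrightarrow> y \<noteq> b"
proof -
  obtain p q where "p \<in> M" "q \<in> M" "\<forall>x\<in>- {b}. p x = q x" "p ` {b} \<inter> q ` {b} = {}"
    using amalgam[of "- {b}"] by auto
  then show thesis by (intro that[of p q]) auto
qed

text \<open>
  Gluing along \<open>{a}\<close> yields ranges meeting in one point, which need not be \<open>a\<close> itself. Density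
  of the units supplies a unit that moves this point to \<open>a\<close>.
\<close>

lemma pair_meeting_at:
  obtains e e' u where "e \<in> M" "e' \<in> M" "e u = a" "e' u = a"
    and "\<And>v w. e v = e' w \<Longrightarrow> e v = a"
proof -
  obtain p q where pq: "p \<in> M" "q \<in> M" "p a = q a" "p ` (- {a}) \<inter> q ` (- {a}) = {}"
    using amalgam[of "{a}"] by auto
  obtain g where g: "g \<in> M" "surj g" "g a = p a"
    using units_dense[OF pq(1), of "{a}"] by auto
  have bij: "bij g" using g injective by (auto simp: bij_def)
  have inv_p: "inv g (p a) = a" using g(3) bij by (metis bij_inv_eq_iff)
  show thesis
  proof
    show "inv g \<circ> p \<in> M" "inv g \<circ> q \<in> M" using comp_mem unit g pq by auto
    show "(inv g \<circ> p) a = a" "(inv g \<circ> q) a = a" using inv_p pq(3) by auto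
    fix v w assume "(inv g \<circ> p) v = (inv g \<circ> q) w"
    then have "p v = q w" using bij by (metis bij_inv_eq_iff comp_apply)
    have "v = a"
    proof (cases "w = a")
      case True
      then show ?thesis using \<open>p v = q w\<close> pq(3) injective[OF pq(1)] by (simp add: inj_def)
    next
      case False
      then have "p v \<in> q ` (- {a})" using \<open>p v = q w\<close> by blast
      then show ?thesis using pq(4) by blast
    qed
    then show "(inv g \<circ> p) v = a" using inv_p by simp
  qed
qed

end

section \<open>Continuity of isomorphisms onto closed monoids\<close>

locale amalgamating_monoid_iso = amalgamating_monoid M
  for M :: "('a::countable \<Rightarrow> 'a) set" +
  fixes N :: "('a \<Rightarrow> 'a) set" and \<phi> :: "('a \<Rightarrow> 'a) \<Rightarrow> ('a \<Rightarrow> 'a)"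
  assumes closed_N: "closed_submonoid N"
    and iso: "\<phi> \<in> iso (full_monoid\<lparr>carrier := M\<rparr>) (full_monoid\<lparr>carrier := N\<rparr>)"
begin

lemma bij: "bij_betw \<phi> M N"
  using iso by (simp add: iso_def)

lemma image_mem: "f \<in> M \<Longrightarrow> \<phi> f \<in> N"
  using bij by (auto simp: bij_betw_def)

lemma image_comp: "f \<in> M \<Longrightarrow> g \<in> M \<Longrightarrow> \<phi> (f \<circ> g) = \<phi> f \<circ> \<phi> g"
  using iso by (auto simp: iso_def hom_def full_monoid_def)

lemma image_eq_iff: "f \<in> M \<Longrightarrow> g \<in> M \<Longrightarrow> \<phi> f = \<phi> g \<longleftrightarrow> f = g"
  using bij by (auto simp: bij_betw_def inj_on_def)

lemma image_id: "\<phi> id = id"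
proof -
  obtain f where f: "f \<in> M" "\<phi> f = id"
    using bij closed_submonoid_id[OF closed_N] unfolding bij_betw_def by (metis imageE)
  have "\<phi> (f \<circ> id) = \<phi> f \<circ> \<phi> id" by (rule image_comp[OF f(1) id_mem])
  then show ?thesis using f(2) by simp
qed

lemma image_unit:
  assumes g: "g \<in> M" "surj g"
  shows "\<phi> (inv g) (\<phi> g x) = x"
proof -
  have "\<phi> (inv g) \<circ> \<phi> g = \<phi> (inv g \<circ> g)"
    using image_comp[OF unit[OF g] g(1)] by simp
  also have "inv g \<circ> g = id" using injective[OF g(1)] by simp
  finally show ?thesis by (metis comp_apply id_apply image_id)
qed

text \<open>
  With \<open>p\<close>, \<open>q\<close> that differ at \<open>f a\<close> only, and \<open>e\<close>, \<open>e'\<close> whose ranges meet in \<open>a\<close> only, \<open>g a = f a\<close>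
  follows from \<open>p \<circ> g \<circ> e \<noteq> q \<circ> g \<circ> e\<close> and \<open>p \<circ> g \<circ> e' \<noteq> q \<circ> g \<circ> e'\<close>: the injective \<open>g\<close> then takes
  the value \<open>f a\<close> on both ranges, hence at their common point. The images under \<open>\<phi>\<close> of these
  inequations are witnessed by one point each.
\<close>

lemma inverse_continuous:
  assumes f: "f \<in> M"
  shows "\<exists>X. finite X \<and> (\<forall>g\<in>M. (\<forall>x\<in>X. \<phi> g x = \<phi> f x) \<longrightarrow> g a = f a)"
proof -
  obtain p q where pq: "p \<in> M" "q \<in> M" "\<And>y. p y = q y \<longleftrightarrow> y \<noteq> f a"
    using separating_pair[where b = "f a"] by blast
  obtain e e' u where e: "e \<in> M" "e' \<in> M" "e u = a" "e' u = a"
    and meet: "\<And>v w. e v = e' w \<Longrightarrow> e v = a"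
    using pair_meeting_at[where a = a] by blast
  have hit: "\<exists>x. \<forall>g\<in>M. \<phi> g x = \<phi> f x \<longrightarrow> (\<exists>v. g (d v) = f a)"
    if d: "d \<in> M" "d u = a" for d
  proof -
    have "p \<circ> (f \<circ> d) \<noteq> q \<circ> (f \<circ> d)"
      using pq(3)[of "f a"] d(2) by (metis comp_apply)
    then have "\<phi> p \<circ> (\<phi> f \<circ> \<phi> d) \<noteq> \<phi> q \<circ> (\<phi> f \<circ> \<phi> d)"
      using pq f d by (simp add: image_eq_iff comp_mem flip: image_comp)
    then obtain z where z: "\<phi> p (\<phi> f (\<phi> d z)) \<noteq> \<phi> q (\<phi> f (\<phi> d z))" by (auto simp: fun_eq_iff)
    have "\<exists>v. g (d v) = f a" if g: "g \<in> M" "\<phi> g (\<phi> d z) = \<phi> f (\<phi> d z)" for g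
    proof -
      have "\<phi> p \<circ> (\<phi> g \<circ> \<phi> d) \<noteq> \<phi> q \<circ> (\<phi> g \<circ> \<phi> d)"
        using z g(2) by (metis comp_apply)
      then have "p \<circ> (g \<circ> d) \<noteq> q \<circ> (g \<circ> d)"
        using pq g d by (simp add: image_eq_iff comp_mem flip: image_comp)
      then show ?thesis using pq(3) by (auto simp: fun_eq_iff)
    qed
    then show ?thesis by blast
  qed
  obtain x where x: "\<And>g. g \<in> M \<Longrightarrow> \<phi> g x = \<phi> f x \<Longrightarrow> \<exists>v. g (e v) = f a"
    using hit e by blast
  obtain x' where x': "\<And>g. g \<in> M \<Longrightarrow> \<phi> g x' = \<phi> f x' \<Longrightarrow> \<exists>v. g (e' v) = f a"
    using hit e by blast
  have "g a = f a" if g: "g \<in> M" "\<forall>z\<in>{x, x'}. \<phi> g z = \<phi> f z" for g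
  proof -
    obtain v w where vw: "g (e v) = f a" "g (e' w) = f a" using x x' g by blast
    then have "e v = e' w" using injective[OF g(1)] by (simp add: inj_def)
    then show ?thesis using meet vw(1) by metis
  qed
  then show ?thesis by (intro exI[of _ "{x, x'}"]) auto
qed

text \<open>
  Although \<open>\<phi>\<close> is not yet known to be continuous, it commutes with limits whenever the images
  converge at all. Since \<open>N\<close> is closed, their limit \<open>h\<close> is \<open>\<phi> d\<close> for some \<open>d\<close>; continuity
  of the inverse makes the sequence converge to \<open>d\<close> as well, so \<open>d = g\<close>.
\<close>

lemma image_limit:
  fixes w :: "nat \<Rightarrow> 'a \<Rightarrow> 'a"
  assumes w: "\<And>n. w n \<in> M" and g: "g \<in> M"
    and lim: "\<And>x. \<exists>m. \<forall>n\<ge>m. w n x = g x"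
    and lim_image: "\<And>x. \<exists>m. \<forall>n\<ge>m. \<phi> (w n) x = h x"
  shows "\<phi> g = h"
proof -
  have common: "\<exists>m. \<forall>n\<ge>m. \<forall>x\<in>X. P n x"
    if "finite X" "\<And>x. \<exists>m. \<forall>n\<ge>m. P n x" for X :: "'a set" and P :: "nat \<Rightarrow> 'a \<Rightarrow> bool"
  proof -
    have "\<forall>x\<in>X. \<forall>\<^sub>F n in sequentially. P n x"
      using that(2) by (simp add: eventually_sequentially)
    then have "\<forall>\<^sub>F n in sequentially. \<forall>x\<in>X. P n x"
      by (rule eventually_ball_finite[OF that(1)])
    then show ?thesis by (simp only: eventually_sequentially)
  qed
  have "h \<in> N"
  proof (rule closed_submonoid_limit[OF closed_N])
    fix F :: "'a set" assume "finite F"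
    from common[where P = "\<lambda>(n :: nat) x. \<phi> (w n) x = h x", OF this lim_image]
    obtain m where "\<forall>x\<in>F. \<phi> (w m) x = h x" by blast
    then show "\<exists>k\<in>N. \<forall>x\<in>F. k x = h x" using image_mem[OF w] by blast
  qed
  then obtain d where d: "d \<in> M" "\<phi> d = h" using bij unfolding bij_betw_def by (metis imageE)
  have "d a = g a" for a
  proof -
    obtain X where X: "finite X" "\<forall>k\<in>M. (\<forall>x\<in>X. \<phi> k x = \<phi> d x) \<longrightarrow> k a = d a"
      using inverse_continuous[OF d(1)] by blast
    obtain m where m: "\<forall>n\<ge>m. \<forall>x\<in>X. \<phi> (w n) x = h x" 
      using common[where P = "\<lambda>(n :: nat) x. \<phi> (w n) x = h x", OF X(1) lim_image] by blast
    obtain m' where m': "\<forall>n\<ge>m'. w n a = g a" using lim by blast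
    have "\<forall>x\<in>X. \<phi> (w (max m m')) x = \<phi> d x" using m d(2) by simp
    then have "w (max m m') a = d a" using X(2) w by blast
    then show ?thesis using m' by simp
  qed
  then have "d = g" by (rule ext)
  then show ?thesis using d(2) by simp
qed

text \<open>
  The units are split into countably many classes according to the action of their images on \<open>X\<close>.
  By Baire's theorem one class \<open>W y\<close> is dense in a nonempty open set of units. Translation by the
  inverse of a member \<open>k0\<close> of that class moves the class to the stabiliser of \<open>X\<close> and the open set to
  a neighbourhood of the identity.
\<close>

lemma stabiliser_somewhere_dense:
  assumes X: "finite X"
  shows "\<exists>F. finite F \<and> (\<forall>g\<in>M. surj g \<longrightarrow> (\<forall>x\<in>F. g x = x) \<longrightarrow> (\<forall>F'. finite F' \<longrightarrow>
     (\<exists>u\<in>M. surj u \<and> (\<forall>x\<in>F'. u x = g x) \<and> (\<forall>x\<in>X. \<phi> u x = x))))"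
proof -
  obtain xs where xs: "set xs = X" using X finite_list by blast
  define G where "G = M \<inter> {g. surj g}"
  define W where "W y = {g \<in> G. map (\<phi> g) xs = y}" for y
  let ?T = "subtopology pointwise_topology G"
  have top: "topspace ?T = G" by simp
  have "gdelta_in pointwise_topology M"
    using closed unfolding closed_submonoid_def
    by (intro closed_imp_gdelta_in completely_metrizable_imp_metrizable_space
        completely_metrizable_pointwise) auto
  then have "completely_metrizable_space ?T"
    unfolding G_def
    by (intro completely_metrizable_space_gdelta_in completely_metrizable_pointwise
        gdelta_in_Int gdelta_surjections)
  moreover have "?T interior_of (\<Union>y. ?T closure_of W y) \<noteq> {}"
  proof -
    have "W y \<subseteq> ?T closure_of W y" for y
      by (rule closure_of_subset) (auto simp: W_def)
    moreover have "g \<in> W (map (\<phi> g) xs)" if "g \<in> G" for g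
      using that by (simp add: W_def)
    moreover have "?T closure_of W y \<subseteq> G" for y
      using closure_of_subset_topspace[of ?T "W y"] unfolding top .
    ultimately have "(\<Union>y. ?T closure_of W y) = topspace ?T"
      unfolding top by blast
    moreover have "id \<in> topspace ?T" using id_mem by (simp add: G_def)
    ultimately show ?thesis by (metis empty_iff interior_of_topspace)
  qed
  moreover have "?T interior_of (\<Union>(range (\<lambda>y. ?T closure_of W y))) = {}"
    if "completely_metrizable_space ?T" "\<And>y. ?T interior_of (?T closure_of W y) = {}"
    using that by (intro Baire_category_alt disjI1) auto
  ultimately obtain y where "?T interior_of (?T closure_of W y) \<noteq> {}" by blast
  then obtain g0 U where U: "openin ?T U" "U \<subseteq> ?T closure_of W y" "g0 \<in> U"
    by (auto simp: interior_of_def)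
  then obtain V where V: "openin pointwise_topology V" "U = V \<inter> G" by (auto simp: openin_subtopology)
  then have "g0 \<in> V" using U(3) by blast
  from V(1)[unfolded openin_pointwise_iff, rule_format, OF this]
  obtain F where F: "finite F" "{g. \<forall>x\<in>F. g x = g0 x} \<subseteq> V" by blast
  have dense: "\<exists>k\<in>W y. \<forall>x\<in>F'. k x = g x"
    if g: "g \<in> G" "\<forall>x\<in>F. g x = g0 x" and F': "finite F'" for g F'
  proof -
    have "g \<in> ?T closure_of W y" using g F(2) V(2) U(2) by blast
    moreover have "openin ?T ({k. \<forall>x\<in>F'. k x = g x} \<inter> G)"
      using F' by (intro openin_subtopology_Int openin_cylinder)
    moreover have "g \<in> {k. \<forall>x\<in>F'. k x = g x} \<inter> G" using g(1) by simp
    ultimately obtain k where "k \<in> W y" "k \<in> {k. \<forall>x\<in>F'. k x = g x} \<inter> G"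
      unfolding in_closure_of by meson
    then show ?thesis by blast
  qed
  have "g0 \<in> G" using U(3) V(2) by blast
  then obtain k0 where k0: "k0 \<in> W y" "\<forall>x\<in>F. k0 x = g0 x" using dense[of g0 F] F(1) by auto
  then have k0G: "k0 \<in> M" "surj k0" by (auto simp: W_def G_def)
  have "\<exists>u\<in>M. surj u \<and> (\<forall>x\<in>F'. u x = g x) \<and> (\<forall>x\<in>X. \<phi> u x = x)"
    if g: "g \<in> M" "surj g" "\<forall>x\<in>F. g x = x" and F': "finite F'" for g F'
  proof -
    \<comment> \<open>\<open>k0 \<circ> g\<close> stays in the open set in which \<open>W y\<close> is dense, and \<open>inv k0\<close> brings the approximation back\<close>
    have "k0 \<circ> g \<in> G" using comp_mem[OF k0G(1) g(1)] comp_surj[OF g(2) k0G(2)] by (simp add: G_def)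
    moreover have "\<forall>x\<in>F. (k0 \<circ> g) x = g0 x" using g k0 by simp
    ultimately obtain k where k: "k \<in> W y" "\<forall>x\<in>F'. k x = (k0 \<circ> g) x" using dense F' by blast
    then have kG: "k \<in> M" "surj k" by (auto simp: W_def G_def)
    show ?thesis
    proof (intro bexI conjI ballI)
      show "inv k0 \<circ> k \<in> M" using k0G kG unit comp_mem by blast
      show "surj (inv k0 \<circ> k)" using k0G kG injective by (intro comp_surj inj_imp_surj_inv) auto
      show "(inv k0 \<circ> k) x = g x" if "x \<in> F'" for x
        using k(2) that injective[OF k0G(1)] by simp
      fix x assume "x \<in> X"
      moreover have "map (\<phi> k) xs = map (\<phi> k0) xs" using k k0 by (simp add: W_def)
      ultimately have "\<phi> k x = \<phi> k0 x" using xs by auto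
      then show "\<phi> (inv k0 \<circ> k) x = x"
        using image_comp[of "inv k0" k] image_unit[OF k0G] unit[OF k0G] kG by simp
    qed
  qed
  then show ?thesis using F(1) by blast
qed

text \<open>
  Let \<open>F n\<close> be a finite set such that the units whose images fix \<open>X n\<close> are dense among the units
  that fix \<open>F n\<close>. Starting from \<open>g\<close> fixing \<open>F 0\<close>, a sequence of products \<open>w n\<close> is built with \<open>w n\<close>
  agreeing with \<open>g\<close> on \<open>F n\<close>: then \<open>inv (w n) \<circ> g\<close> fixes \<open>F n\<close>, and the next factor \<open>u\<close> is chosen close
  to it with \<open>\<phi> u\<close> fixing \<open>X n\<close>. The images of the products become stationary at every point,
  so that \<open>image_limit\<close> applies. The point \<open>x\<close> is put into every \<open>X n\<close>; hence all these images fix it.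
\<close>

lemma stabiliser_open:
  "\<exists>F. finite F \<and> (\<forall>g\<in>M. surj g \<longrightarrow> (\<forall>y\<in>F. g y = y) \<longrightarrow> \<phi> g x = x)"
proof -
  define X where "X n = insert x (initial n)" for n
  define D where "D n F \<longleftrightarrow> (\<forall>g\<in>M. surj g \<longrightarrow> (\<forall>x\<in>F. g x = x) \<longrightarrow> (\<forall>F'. finite F' \<longrightarrow>
     (\<exists>u\<in>M. surj u \<and> (\<forall>x\<in>F'. u x = g x) \<and> (\<forall>x\<in>X n. \<phi> u x = x))))" for n F
  have "\<exists>F. finite F \<and> D n F" for n
    unfolding D_def by (rule stabiliser_somewhere_dense) (simp add: X_def)
  then obtain F where F: "\<And>n. finite (F n)" "\<And>n. D n (F n)" by metis
  have "\<phi> g x = x" if g: "g \<in> M" "surj g" "\<forall>y\<in>F 0. g y = y" for g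
  proof -
    define P where "P n w \<longleftrightarrow> w \<in> M \<and> surj w \<and> (\<forall>y\<in>F n. w y = g y) \<and> (\<forall>y\<in>initial n. w y = g y)
      \<and> (n = 0 \<longrightarrow> w = id)" for n w
    have "\<exists>w. \<forall>n. P n (w n) \<and> (\<forall>y\<in>X n. \<phi> (w (Suc n)) y = \<phi> (w n) y)"
    proof (rule dependent_nat_choice)
      show "\<exists>w. P 0 w" using g id_mem by (intro exI[of _ id]) (auto simp: P_def initial_def)
    next
      fix w n assume "P n w"
      then have w: "w \<in> M" "surj w" "\<forall>y\<in>F n. w y = g y" by (auto simp: P_def)
      have invw: "inv w (w y) = y" "w (inv w y) = y" for y
        using injective[OF w(1)] w(2) by (simp_all add: surj_f_inv_f)
      have "inv w \<circ> g \<in> M" "surj (inv w \<circ> g)"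
        using comp_mem[OF unit[OF w(1,2)] g(1)]
          comp_surj[OF g(2) inj_imp_surj_inv[OF injective[OF w(1)]]] by auto
      moreover have "\<forall>y\<in>F n. (inv w \<circ> g) y = y"
      proof
        fix y assume "y \<in> F n"
        then have "g y = w y" using w(3) by simp
        then show "(inv w \<circ> g) y = y" using invw(1) by simp
      qed
      moreover have "finite (F (Suc n) \<union> initial (Suc n))" using F(1) by simp
      ultimately have "\<exists>u\<in>M. surj u \<and> (\<forall>y\<in>F (Suc n) \<union> initial (Suc n). u y = (inv w \<circ> g) y)
          \<and> (\<forall>y\<in>X n. \<phi> u y = y)"
        using F(2)[of n] unfolding D_def by presburger
      then obtain u where u: "u \<in> M" "surj u"
        "\<forall>y\<in>F (Suc n) \<union> initial (Suc n). u y = (inv w \<circ> g) y" "\<forall>y\<in>X n. \<phi> u y = y"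
        by blast
      have "P (Suc n) (w \<circ> u)"
        unfolding P_def
      proof (intro conjI)
        show "w \<circ> u \<in> M" by (rule comp_mem[OF w(1) u(1)])
        show "surj (w \<circ> u)" by (rule comp_surj[OF u(2) w(2)])
      qed (use u(3) invw(2) in auto)
      moreover have "\<forall>y\<in>X n. \<phi> (w \<circ> u) y = \<phi> w y"
        using u(4) image_comp[OF w(1) u(1)] by simp
      ultimately show "\<exists>v. P (Suc n) v \<and> (\<forall>y\<in>X n. \<phi> v y = \<phi> w y)" by blast
    qed
    then obtain w where "\<forall>n. P n (w n) \<and> (\<forall>y\<in>X n. \<phi> (w (Suc n)) y = \<phi> (w n) y)" ..
    then have w: "P n (w n)" "y \<in> X n \<Longrightarrow> \<phi> (w (Suc n)) y = \<phi> (w n) y" for n y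
      by simp_all
    have wM: "w n \<in> M" and w_initial: "y \<in> initial n \<Longrightarrow> w n y = g y" for n y
      using w(1)[of n] unfolding P_def by blast+
    have w0: "w 0 = id" using w(1)[of 0] unfolding P_def by blast
    \<comment> \<open>right factors that fix \<open>X n\<close> do not change the values of the product there\<close>
    have const: "\<phi> (w n) y = \<phi> (w m) y" if "y \<in> X m" "m \<le> n" for y m n
      using that(2)
    proof (induction n rule: dec_induct)
      case (step n)
      then have "y \<in> X n" using that(1) initial_mono[of m n] by (auto simp: X_def)
      then show ?case using w(2) step by simp
    qed simp
    have in_X: "y \<in> X (Suc (to_nat y))" for y by (simp add: X_def initial_def)
    have "\<phi> g = (\<lambda>y. \<phi> (w (Suc (to_nat y))) y)"
    proof (rule image_limit)
      show "w n \<in> M" for n by (rule wM)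
      show "g \<in> M" by fact
      show "\<exists>m. \<forall>n\<ge>m. w n y = g y" for y
      proof (intro exI allI impI)
        fix n assume "Suc (to_nat y) \<le> n"
        then show "w n y = g y" by (intro w_initial) (simp add: initial_def)
      qed
      show "\<exists>m. \<forall>n\<ge>m. \<phi> (w n) y = \<phi> (w (Suc (to_nat y))) y" for y
        using const[OF in_X] by blast
    qed
    then have "\<phi> g x = \<phi> (w (Suc (to_nat x))) x" by (rule fun_cong)
    also have "\<dots> = \<phi> (w 0) x" by (rule const) (auto simp: X_def)
    also have "\<dots> = x" by (simp add: w0 image_id)
    finally show ?thesis .
  qed
  then show ?thesis by (intro exI[of _ "F 0"]) (simp add: F(1))
qed

text \<open>
  On units, \<open>stabiliser_open\<close> makes the value of \<open>\<phi> g\<close> at \<open>y\<close> depend on the restriction of \<open>g\<close> to a finite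
  set \<open>S y\<close> only. Therefore a sequence of units converging to \<open>f\<close> has converging images, whose
  limit is \<open>\<phi> f\<close>, and \<open>f\<close> obeys the same rule as the units.
\<close>

lemma image_locally_constant:
  assumes f: "f \<in> M"
  shows "\<exists>F. finite F \<and> (\<forall>k\<in>M. (\<forall>y\<in>F. k y = f y) \<longrightarrow> \<phi> k x = \<phi> f x)"
proof -
  obtain S where finS: "\<And>y. finite (S y)"
    and S: "\<And>y g. g \<in> M \<Longrightarrow> surj g \<Longrightarrow> \<forall>z\<in>S y. g z = z \<Longrightarrow> \<phi> g y = y"
    using stabiliser_open by metis
  have agree: "\<phi> g y = \<phi> h y"
    if g: "g \<in> M" "surj g" and h: "h \<in> M" "surj h" and gh: "\<forall>z\<in>S y. g z = h z" for g h y
  proof -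
    have inv: "inv h (h z) = z" "h (inv h z) = z" for z
      using injective[OF h(1)] h(2) by (simp_all add: surj_f_inv_f)
    have u: "inv h \<circ> g \<in> M" "surj (inv h \<circ> g)"
      using comp_mem[OF unit[OF h] g(1)]
        comp_surj[OF g(2) inj_imp_surj_inv[OF injective[OF h(1)]]] by auto
    have "\<phi> (inv h \<circ> g) y = y"
      using gh inv(1) by (intro S u) simp
    moreover have "h \<circ> (inv h \<circ> g) = g" using inv(2) by (simp add: fun_eq_iff)
    ultimately show ?thesis using image_comp[OF h(1) u(1)] by (metis comp_apply)
  qed
  have transfer: "\<phi> g y = \<phi> f y"
    if f: "f \<in> M" and g: "g \<in> M" "surj g" and gf: "\<forall>z\<in>S y. g z = f z" for f g y
  proof -
    have "\<forall>n. \<exists>w\<in>M. surj w \<and> (\<forall>z\<in>initial n. w z = f z)"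
      using units_dense[OF f] by simp
    then obtain w where w: "\<And>n. w n \<in> M" "\<And>n. surj (w n)"
      "\<And>n z. z \<in> initial n \<Longrightarrow> w n z = f z" by metis
    obtain m where m: "\<And>y. S y \<subseteq> initial (m y)"
      using finite_subset_initial[OF finS] by metis
    have w_eq: "w n z = f z" if "m y \<le> n" "z \<in> S y" for n y z
      using w(3) m initial_mono[OF that(1)] that(2) by blast
    have "\<phi> f = (\<lambda>y. \<phi> (w (m y)) y)"
    proof (rule image_limit[OF w(1) f])
      show "\<exists>k. \<forall>n\<ge>k. w n z = f z" for z
      proof (intro exI allI impI)
        fix n assume "Suc (to_nat z) \<le> n"
        then show "w n z = f z" by (intro w(3)) (simp add: initial_def)
      qed
      show "\<exists>k. \<forall>n\<ge>k. \<phi> (w n) y = \<phi> (w (m y)) y" for y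
      proof (intro exI allI impI)
        fix n assume "m y \<le> n"
        then show "\<phi> (w n) y = \<phi> (w (m y)) y"
          by (intro agree w) (simp add: w_eq[where y = y])
      qed
    qed
    then have "\<phi> f y = \<phi> (w (m y)) y" by (rule fun_cong)
    also have "\<dots> = \<phi> g y"
      by (intro agree w g) (simp add: w_eq[where y = y] gf)
    finally show ?thesis by simp
  qed
  obtain g where g: "g \<in> M" "surj g" "\<forall>z\<in>S x. g z = f z"
    using units_dense[OF f finS] by blast
  have "\<phi> k x = \<phi> f x" if k: "k \<in> M" "\<forall>z\<in>S x. k z = f z" for k
    using transfer[OF f g] transfer[OF k(1) g(1,2)] g(3) k(2) by simp
  then show ?thesis using finS by blast
qed

lemma homeomorphism:
  "homeomorphic_map (subtopology pointwise_topology M) (subtopology pointwise_topology N) \<phi>"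
proof -
  let ?\<psi> = "inv_into M \<phi>"
  have \<psi>: "?\<psi> h \<in> M" "\<phi> (?\<psi> h) = h" if "h \<in> N" for h
    using that bij by (auto simp: bij_betw_def inv_into_into f_inv_into_f)
  have "homeomorphic_maps (subtopology pointwise_topology M) (subtopology pointwise_topology N) \<phi> ?\<psi>"
    unfolding homeomorphic_maps_def
  proof (intro conjI)
    show "continuous_map (subtopology pointwise_topology M) (subtopology pointwise_topology N) \<phi>"
      by (intro continuous_map_pointwise image_mem image_locally_constant)
    show "continuous_map (subtopology pointwise_topology N) (subtopology pointwise_topology M) ?\<psi>"
    proof (rule continuous_map_pointwise)
      fix h a assume h: "h \<in> N"
      obtain X where X: "finite X" "\<forall>g\<in>M. (\<forall>x\<in>X. \<phi> g x = \<phi> (?\<psi> h) x) \<longrightarrow> g a = ?\<psi> h a"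
        using inverse_continuous[OF \<psi>(1)[OF h]] by blast
      have "?\<psi> k a = ?\<psi> h a" if k: "k \<in> N" "\<forall>x\<in>X. k x = h x" for k
        using X(2) \<psi>(1)[OF k(1)] \<psi>(2)[OF k(1)] \<psi>(2)[OF h] k(2) by metis
      then show "\<exists>F. finite F \<and> (\<forall>k\<in>N. (\<forall>x\<in>F. k x = h x) \<longrightarrow> ?\<psi> k a = ?\<psi> h a)"
        using X(1) by blast
    qed (rule \<psi>(1))
    show "\<forall>f\<in>topspace (subtopology pointwise_topology M). ?\<psi> (\<phi> f) = f"
      using bij by (auto simp: bij_betw_def)
    show "\<forall>h\<in>topspace (subtopology pointwise_topology N). \<phi> (?\<psi> h) = h"
      using \<psi>(2) by auto
  qed
  then show ?thesis unfolding homeomorphic_map_maps by blast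
qed

end

theorem (in amalgamating_monoid) automatically_homeomorphic:
  "\<forall>(N :: ('a \<Rightarrow> 'a) set) \<phi>. closed_submonoid N \<longrightarrow>
     \<phi> \<in> iso (full_monoid\<lparr>carrier := M\<rparr>) (full_monoid\<lparr>carrier := N\<rparr>) \<longrightarrow>
     homeomorphic_map (subtopology pointwise_topology M) (subtopology pointwise_topology N) \<phi>"
proof (intro allI impI)
  fix N :: "('a \<Rightarrow> 'a) set" and \<phi>
  assume "closed_submonoid N"
    and "\<phi> \<in> iso (full_monoid\<lparr>carrier := M\<rparr>) (full_monoid\<lparr>carrier := N\<rparr>)"
  then interpret amalgamating_monoid_iso M N \<phi>
    by unfold_locales
  show "homeomorphic_map (subtopology pointwise_topology M) (subtopology pointwise_topology N) \<phi>"
    by (rule homeomorphism)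
qed

section \<open>Self-embedding monoids of homogeneous structures\<close>

lemma self_embeddings_iff:
  "f \<in> self_embeddings R \<longleftrightarrow> inj f \<and> (\<forall>xs. map f xs \<in> R \<longleftrightarrow> xs \<in> R)"
  by (simp add: self_embeddings_def embedding_def)

lemma closed_self_embeddings: "closed_submonoid (self_embeddings R)"
proof -
  have "submonoid (self_embeddings R) full_monoid"
    by unfold_locales
      (auto simp: full_monoid_def self_embeddings_iff inj_compose simp flip: map_map)
  moreover have "f \<in> self_embeddings R"
    if f: "\<And>F. finite F \<Longrightarrow> \<exists>g\<in>self_embeddings R. \<forall>x\<in>F. g x = f x" for f
    unfolding self_embeddings_iff
  proof (intro conjI allI injI)
    fix x y assume "f x = f y"
    moreover obtain g where "g \<in> self_embeddings R" "\<forall>z\<in>{x, y}. g z = f z" using f[of "{x, y}"] by auto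
    ultimately show "x = y" by (simp add: self_embeddings_iff inj_def)
  next
    fix xs
    obtain g where g: "g \<in> self_embeddings R" "\<forall>z\<in>set xs. g z = f z" using f[of "set xs"] by auto
    then have "map f xs = map g xs" by simp
    then show "map f xs \<in> R \<longleftrightarrow> xs \<in> R" using g(1) unfolding self_embeddings_iff by metis
  qed
  ultimately show ?thesis
    unfolding closed_submonoid_def closedin_pointwise_iff by blast
qed

lemma embedding_induced: "embedding X (induced S X) A R f \<longleftrightarrow> embedding X S A R f"
  by (auto simp: embedding_def induced_def)

lemma isomorphism_induced_iff:
  "isomorphism X (induced S X) Y (induced R Y) f \<longleftrightarrow> embedding X S UNIV R f \<and> f ` X = Y"
proof -
  have "map f xs \<in> induced R (f ` X) \<longleftrightarrow> map f xs \<in> R" if "xs \<in> lists X" for xs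
    using that by (auto simp: induced_def in_lists_conv_set)
  then have "embedding X S (f ` X) (induced R (f ` X)) f \<longleftrightarrow> embedding X S UNIV R f"
    by (simp add: embedding_def)
  then show ?thesis
    unfolding isomorphism_def embedding_induced by blast
qed

lemma embedding_mono: "embedding Y S A R f \<Longrightarrow> X \<subseteq> Y \<Longrightarrow> embedding X S A R f"
  unfolding embedding_def using lists_mono[of X Y] by (auto intro: inj_on_subset)

lemma amalgamating_self_embeddings:
  fixes R :: "'a::countable list set"
  assumes hom: "homogeneous UNIV R"
    and amalgam: "\<And>C. \<exists>p\<in>self_embeddings R. \<exists>q\<in>self_embeddings R.
      (\<forall>x\<in>C. p x = q x) \<and> p ` (- C) \<inter> q ` (- C) = {}"
  shows "amalgamating_monoid (self_embeddings R)"
proof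
  show "closed_submonoid (self_embeddings R)" by (rule closed_self_embeddings)
  show "inj f" if "f \<in> self_embeddings R" for f using that by (simp add: self_embeddings_iff)
  show "inv g \<in> self_embeddings R" if g: "g \<in> self_embeddings R" "surj g" for g
    unfolding self_embeddings_iff
  proof (intro conjI allI)
    show "inj (inv g)" using g(2) by (rule surj_imp_inj_inv)
    fix xs
    have "map g (map (inv g) xs) = xs" using g(2) by (simp add: surj_f_inv_f map_idI)
    then show "map (inv g) xs \<in> R \<longleftrightarrow> xs \<in> R" using g(1) by (metis self_embeddings_iff)
  qed
  show "\<exists>g\<in>self_embeddings R. surj g \<and> (\<forall>x\<in>F. g x = f x)"
    if f: "f \<in> self_embeddings R" "finite F" for f F
  proof -
    have "embedding F R UNIV R f"
      using f(1) embedding_mono[of UNIV R UNIV R f F] by (simp add: self_embeddings_def)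
    then have "isomorphism F (induced R F) (f ` F) (induced R (f ` F)) f"
      unfolding isomorphism_induced_iff by simp
    then obtain g where "isomorphism UNIV R UNIV R g" "\<forall>x\<in>F. g x = f x"
      using hom f(2) unfolding homogeneous_def by blast
    then show ?thesis by (auto simp: isomorphism_def self_embeddings_def)
  qed
  show "\<exists>p\<in>self_embeddings R. \<exists>q\<in>self_embeddings R.
      (\<forall>x\<in>C. p x = q x) \<and> p ` (- C) \<inter> q ` (- C) = {}" for C
    by (rule amalgam)
qed

text \<open>
  The two embeddings of \<open>X\<close> differ by an isomorphism between finite substructures of the homogeneous
  structure. Extending it to an automorphism and composing with \<open>g\<close> corrects \<open>g\<close> on \<open>X\<close>.
\<close>

lemma embedding_extends:
  assumes hom: "homogeneous UNIV R"
    and f: "embedding X S UNIV R f" and g: "embedding Y S UNIV R g"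
    and XY: "X \<subseteq> Y" "finite X"
  shows "\<exists>h. embedding Y S UNIV R h \<and> (\<forall>x\<in>X. h x = f x)"
proof -
  have gX: "embedding X S UNIV R g" using g XY(1) by (rule embedding_mono)
  then have inj: "inj_on g X" by (simp add: embedding_def)
  define k where "k = f \<circ> inv_into X g"
  have k: "k (g x) = f x" if "x \<in> X" for x using inj that by (simp add: k_def)
  have "embedding (g ` X) R UNIV R k"
    unfolding embedding_def
  proof (intro conjI ballI)
    show "inj_on k (g ` X)"
      using f by (intro inj_onI) (auto simp: k embedding_def dest: inj_onD)
    fix ys assume "ys \<in> lists (g ` X)"
    then obtain xs where xs: "xs \<in> lists X" "ys = map g xs" by (auto simp: lists_image)
    have "map k ys = map f xs" using xs k by (auto simp: in_lists_conv_set)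
    moreover have "map f xs \<in> R \<longleftrightarrow> ys \<in> R" using f gX xs by (simp add: embedding_def)
    ultimately show "map k ys \<in> R \<longleftrightarrow> ys \<in> R" by (simp only:)
  qed simp
  then have "isomorphism (g ` X) (induced R (g ` X)) (k ` g ` X) (induced R (k ` g ` X)) k"
    unfolding isomorphism_induced_iff by simp
  then obtain \<theta> where \<theta>: "isomorphism UNIV R UNIV R \<theta>" "\<forall>x\<in>g ` X. \<theta> x = k x"
    using hom XY(2) unfolding homogeneous_def by (metis finite_imageI subset_UNIV)
  then have \<theta>': "inj \<theta>" "\<And>xs. map \<theta> xs \<in> R \<longleftrightarrow> xs \<in> R"
    by (simp_all add: isomorphism_def embedding_def)
  have "embedding Y S UNIV R (\<theta> \<circ> g)"
    using g \<theta>' by (auto simp: embedding_def inj_on_def simp flip: map_map)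
  moreover have "\<forall>x\<in>X. (\<theta> \<circ> g) x = f x" using \<theta>(2) k by simp
  ultimately show ?thesis by blast
qed

text \<open>
  Universality of homogeneous structures for countable ones: embeddings of the members of an increasing chain
  of finite parts can be chosen to extend each other.
\<close>

lemma embedding_if_finite_embeddings:
  fixes B :: "'b::countable set"
  assumes hom: "homogeneous UNIV R"
    and fin: "\<And>X. finite X \<Longrightarrow> X \<subseteq> B \<Longrightarrow> \<exists>f. embedding X S UNIV R f"
  shows "\<exists>f. embedding B S UNIV R f"
proof -
  define X where "X n = B \<inter> initial n" for n
  have X: "finite (X n)" "X n \<subseteq> B" "X n \<subseteq> X (Suc n)" for n
    using initial_mono[of n "Suc n"] by (auto simp: X_def)
  have "\<exists>f. \<forall>n. embedding (X n) S UNIV R (f n) \<and> (\<forall>x\<in>X n. f (Suc n) x = f n x)"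
  proof (rule dependent_nat_choice)
    show "\<exists>f. embedding (X 0) S UNIV R f" by (rule fin[OF X(1,2)])
    fix f n assume "embedding (X n) S UNIV R f"
    moreover obtain g where "embedding (X (Suc n)) S UNIV R g" using fin[OF X(1,2)] by blast
    ultimately show "\<exists>h. embedding (X (Suc n)) S UNIV R h \<and> (\<forall>x\<in>X n. h x = f x)"
      by (rule embedding_extends[OF hom _ _ X(3,1)])
  qed
  then obtain f where f: "\<And>n. embedding (X n) S UNIV R (f n)"
    and step: "\<And>n x. x \<in> X n \<Longrightarrow> f (Suc n) x = f n x" by blast
  have const: "f n x = f m x" if "x \<in> X m" "m \<le> n" for x m n
    using that(2)
  proof (induction n rule: dec_induct)
    case (step n)
    have "x \<in> X n" using that(1) initial_mono[OF step(1)] by (auto simp: X_def)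
    then show ?case using \<open>\<And>n x. x \<in> X n \<Longrightarrow> f (Suc n) x = f n x\<close> step(3) by simp
  qed simp
  define h where "h x = f (Suc (to_nat x)) x" for x
  have h: "h x = f n x" if "x \<in> X n" for x n
  proof -
    have "x \<in> X (Suc (to_nat x))" "Suc (to_nat x) \<le> n" using that by (auto simp: X_def initial_def)
    then show ?thesis unfolding h_def by (rule const[symmetric])
  qed
  have "embedding (X n) S UNIV R h" for n
  proof -
    have "map h xs \<in> R \<longleftrightarrow> xs \<in> S" if "xs \<in> lists (X n)" for xs
    proof -
      have "map h xs = map (f n) xs" using that h by (auto simp: in_lists_conv_set)
      moreover have "map (f n) xs \<in> R \<longleftrightarrow> xs \<in> S" using that f by (simp add: embedding_def)
      ultimately show ?thesis by (simp only:)
    qed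
    moreover have "inj_on h (X n)"
      using f[of n] inj_on_cong[of "X n" h "f n"] h by (auto simp: embedding_def)
    ultimately show ?thesis unfolding embedding_def by simp
  qed
  note hX = this
  have finite_in: "\<exists>n. F \<subseteq> X n" if "finite F" "F \<subseteq> B" for F
    using finite_subset_initial[OF that(1)] that(2) by (auto simp: X_def)
  have "embedding B S UNIV R h"
    unfolding embedding_def
  proof (intro conjI inj_onI ballI)
    fix x y assume "x \<in> B" "y \<in> B" "h x = h y"
    moreover then obtain n where "{x, y} \<subseteq> X n" using finite_in[of "{x, y}"] by auto
    ultimately show "x = y" using hX[of n] by (auto simp: embedding_def dest: inj_onD)
  next
    fix xs assume "xs \<in> lists B"
    then obtain n where "set xs \<subseteq> X n" using finite_in[of "set xs"] by auto
    then have "xs \<in> lists (X n)" by auto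
    then show "map h xs \<in> R \<longleftrightarrow> xs \<in> S" using hX[of n] by (simp add: embedding_def)
  qed simp
  then show ?thesis by blast
qed

section \<open>Gluing two copies of a structure\<close>

text \<open>
  The glued structure lives on a subset of the type \<open>'a\<close> itself, so that its finite parts can be
  compared directly with a class \<open>K\<close> of structures on \<open>'a\<close>.
\<close>

lemma two_copies:
  fixes C :: "'a::{countable,infinite} set"
  obtains i j :: "'a \<Rightarrow> 'a" where "inj i" "inj j" "\<And>x y. i x = j y \<longleftrightarrow> x = y \<and> x \<in> C"
proof -
  obtain c :: "nat \<Rightarrow> 'a" where "inj c"
    using infinite_UNIV infinite_countable_subset by blast
  then have c [simp]: "c m = c n \<longleftrightarrow> m = n" for m n by (simp add: inj_eq)
  have odd [simp]: "2 * m \<noteq> Suc (2 * n)" "Suc (2 * n) \<noteq> 2 * m" for m n :: nat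
    by presburger+
  \<comment> \<open>first copy at even codes; the part of the second copy outside \<open>C\<close> at odd codes\<close>
  define i where "i x = c (2 * to_nat x)" for x :: 'a
  define j where "j x = (if x \<in> C then i x else c (Suc (2 * to_nat x)))" for x :: 'a
  show thesis
  proof
    show "inj i" by (rule injI) (simp add: i_def)
    show "inj j" by (rule injI) (simp add: i_def j_def split: if_splits)
    show "i x = j y \<longleftrightarrow> x = y \<and> x \<in> C" for x y
      by (auto simp: i_def j_def)
  qed
qed

lemma map_mem_map_imageD:
  assumes "map f xs \<in> map g ` R" and fg: "\<And>x y. f x = g y \<Longrightarrow> x = y"
  shows "xs \<in> R"
proof -
  obtain ys where ys: "ys \<in> R" "map f xs = map g ys" using assms(1) by blast
  have len: "length xs = length ys" using ys(2) by (rule map_eq_imp_length_eq)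
  have "xs ! n = ys ! n" if "n < length xs" for n
  proof (rule fg)
    have "map f xs ! n = map g ys ! n" by (simp only: ys(2))
    then show "f (xs ! n) = g (ys ! n)" using that len by simp
  qed
  then have "xs = ys" by (intro nth_equalityI len)
  then show ?thesis using ys(1) by simp
qed

text \<open>
  The set \<open>E\<close> consists of the tuples that relate the two copies to each other. As none of them lies
  within one copy, both copies carry the structure \<open>R\<close>.
\<close>

lemma self_amalgam:
  fixes R :: "'a::{countable,infinite} list set"
  assumes lim: "fraisse_limit K UNIV R"
    and glue: "\<And>i j. inj i \<Longrightarrow> inj j \<Longrightarrow> (\<And>x y. i x = j y \<longleftrightarrow> x = y \<and> x \<in> C) \<Longrightarrow>
      \<exists>E. (\<forall>zs\<in>E. \<not> set zs \<subseteq> range i \<and> \<not> set zs \<subseteq> range j) \<and>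
        (\<forall>X. finite X \<longrightarrow> X \<subseteq> range i \<union> range j \<longrightarrow>
          K X (induced (map i ` R \<union> map j ` R \<union> E) X))"
  shows "\<exists>p\<in>self_embeddings R. \<exists>q\<in>self_embeddings R.
    (\<forall>x\<in>C. p x = q x) \<and> p ` (- C) \<inter> q ` (- C) = {}"
proof -
  obtain i j :: "'a \<Rightarrow> 'a" where ij: "inj i" "inj j" "\<And>x y. i x = j y \<longleftrightarrow> x = y \<and> x \<in> C"
    using two_copies[of C] by blast
  obtain E where E: "\<And>zs. zs \<in> E \<Longrightarrow> \<not> set zs \<subseteq> range i \<and> \<not> set zs \<subseteq> range j"
    and fin: "\<And>X. finite X \<Longrightarrow> X \<subseteq> range i \<union> range j \<Longrightarrow>
          K X (induced (map i ` R \<union> map j ` R \<union> E) X)"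
    using glue[OF ij] by blast
  define S where "S = map i ` R \<union> map j ` R \<union> E"
  have pull: "map f xs \<in> S \<longleftrightarrow> xs \<in> R" if f: "f = i \<or> f = j" for f xs
  proof
    have fi: "x = y" if "f x = i y" for x y
      using f that inj_eq[OF ij(1), of x y] ij(3)[of y x] by auto
    have fj: "x = y" if "f x = j y" for x y
      using f that inj_eq[OF ij(2), of x y] ij(3)[of x y] by auto
    assume "map f xs \<in> S"
    then consider "map f xs \<in> map i ` R" | "map f xs \<in> map j ` R" | "map f xs \<in> E"
      unfolding S_def by blast
    then show "xs \<in> R"
    proof cases
      case 1
      then show ?thesis by (rule map_mem_map_imageD) (rule fi)
    next
      case 2
      then show ?thesis by (rule map_mem_map_imageD) (rule fj)
    next
      case 3
      moreover have "set (map f xs) \<subseteq> range f" by auto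
      ultimately show ?thesis using E[of "map f xs"] f by blast
    qed
  next
    assume "xs \<in> R"
    then show "map f xs \<in> S" using f unfolding S_def by blast
  qed
  have hom: "homogeneous UNIV R" using lim by (simp add: fraisse_limit_def)
  have universal: "\<exists>Y f. Y \<subseteq> UNIV \<and> isomorphism X T Y (induced R Y) f" if "finite X" "K X T" for X T
    using lim that by (simp add: fraisse_limit_def)
  have "\<exists>f. embedding X S UNIV R f" if X: "finite X" "X \<subseteq> range i \<union> range j" for X
  proof -
    have "K X (induced S X)" unfolding S_def by (rule fin[OF X])
    from universal[OF X(1) this] show ?thesis unfolding isomorphism_induced_iff by blast
  qed
  from embedding_if_finite_embeddings[OF hom this]
  obtain e where e: "embedding (range i \<union> range j) S UNIV R e" by blast
  have e_inj: "u = v" if "e u = e v" "u \<in> range i \<union> range j" "v \<in> range i \<union> range j" for u v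
    using e that unfolding embedding_def by (blast dest: inj_onD)
  have e_rel: "map e zs \<in> R \<longleftrightarrow> zs \<in> S" if "set zs \<subseteq> range i \<union> range j" for zs
  proof -
    have "zs \<in> lists (range i \<union> range j)" using that by (simp add: subset_eq in_lists_conv_set)
    then show ?thesis using e unfolding embedding_def by blast
  qed
  have "e \<circ> f \<in> self_embeddings R"
    if f: "inj f" "range f \<subseteq> range i \<union> range j" "f = i \<or> f = j" for f
    unfolding self_embeddings_iff
  proof (intro conjI allI)
    show "inj (e \<circ> f)"
    proof (rule injI)
      fix x y assume "(e \<circ> f) x = (e \<circ> f) y"
      then have "e (f x) = e (f y)" by simp
      then have "f x = f y" by (rule e_inj) (use f(2) in blast)+
      then show "x = y" using f(1) by (simp add: inj_eq)
    qed
    fix xs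
    have "set (map f xs) \<subseteq> range i \<union> range j" using f(2) by auto
    then show "map (e \<circ> f) xs \<in> R \<longleftrightarrow> xs \<in> R" using e_rel pull[OF f(3)] by (metis map_map)
  qed
  then have "e \<circ> i \<in> self_embeddings R" "e \<circ> j \<in> self_embeddings R"
    using ij(1,2) by blast+
  moreover have "(e \<circ> i) ` (- C) \<inter> (e \<circ> j) ` (- C) = {}" 
  proof -
    have "e (i x) \<noteq> e (j y)" if "x \<notin> C" for x y
      using e_inj[of "i x" "j y"] ij(3)[of x y] that by blast
    then show ?thesis by auto
  qed
  moreover have "(e \<circ> i) x = (e \<circ> j) x" if "x \<in> C" for x
    using ij(3)[of x x] that by simp
  ultimately show ?thesis by blast
qed

section \<open>The classes of finite structures\<close>

lemma mem_induced [simp]: "xs \<in> induced R X \<longleftrightarrow> xs \<in> R \<and> set xs \<subseteq> X"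
  by (auto simp: induced_def)

lemma finite_part: "fraisse_limit K UNIV R \<Longrightarrow> K (set xs) (induced R (set xs))"
  by (simp add: fraisse_limit_def)

lemma pair_mem_pairs [simp]: "[x, y] \<in> pairs E \<longleftrightarrow> (x, y) \<in> E"
  by (simp add: pairs_def)

lemma length_2_iff: "length xs = 2 \<longleftrightarrow> (\<exists>x y. xs = [x, y])"
  by (auto simp: numeral_2_eq_2 length_Suc_conv)

lemma pairs_of_binary:
  assumes "S \<subseteq> lists A" "\<forall>xs\<in>S. length xs = 2"
  obtains E where "E \<subseteq> A \<times> A" "S = pairs E"
proof
  show "{(x, y). [x, y] \<in> S} \<subseteq> A \<times> A" using assms(1) by auto
  show "S = pairs {(x, y). [x, y] \<in> S}"
    using assms(2) by (auto simp: pairs_def length_2_iff)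
qed

lemma mset_eq_pair_iff: "mset ys = {#x, y#} \<longleftrightarrow> ys = [x, y] \<or> ys = [y, x]"
proof
  assume *: "mset ys = {#x, y#}"
  then have "length ys = 2" using mset_eq_length[of ys "[x, y]"] by simp
  then obtain u v where "ys = [u, v]" by (auto simp: length_2_iff)
  then show "ys = [x, y] \<or> ys = [y, x]" using * by (auto simp: add_eq_conv_ex)
qed auto

lemma finite_graph_iff:
  "finite_graph A S \<longleftrightarrow> finite_hypergraph 2 A S"
proof
  assume "finite_graph A S"
  then obtain E where E: "finite A" "E \<subseteq> A \<times> A" "irrefl E" "sym E" "S = pairs E"
    unfolding finite_graph_def by blast
  have "length xs = 2 \<and> distinct xs \<and> set xs \<subseteq> A \<and> (\<forall>ys. mset ys = mset xs \<longrightarrow> ys \<in> S)"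
    if xs: "xs \<in> S" for xs
  proof -
    obtain x y where xy: "xs = [x, y]" "(x, y) \<in> E" using xs E(5) by (auto simp: pairs_def)
    then have "x \<noteq> y" "(y, x) \<in> E" using E(3,4) by (auto simp: irrefl_def dest: symD)
    then show ?thesis using xy E(2,5) by (auto simp: mset_eq_pair_iff)
  qed
  then show "finite_hypergraph 2 A S"
    using E(1) unfolding finite_hypergraph_def by (auto simp: in_lists_conv_set)
next
  assume *: "finite_hypergraph 2 A S"
  then obtain E where E: "E \<subseteq> A \<times> A" "S = pairs E"
    using pairs_of_binary[of S A] unfolding finite_hypergraph_def by blast
  have "x \<noteq> y \<and> (y, x) \<in> E" if "(x, y) \<in> E" for x y
  proof -
    have xy: "[x, y] \<in> S" using that E(2) by simp
    then have "distinct [x, y]" using * unfolding finite_hypergraph_def by blast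
    moreover have "mset [y, x] = mset [x, y]" by simp
    then have "[y, x] \<in> S" using * xy unfolding finite_hypergraph_def by blast
    ultimately show ?thesis using E(2) by simp
  qed
  then have "irrefl E" "sym E" by (auto simp: irrefl_def sym_def)
  then show "finite_graph A S"
    using * E unfolding finite_graph_def finite_hypergraph_def by blast
qed

lemma finite_digraph_iff:
  "finite_digraph A S \<longleftrightarrow> finite A \<and> S \<subseteq> lists A \<and> (\<forall>xs\<in>S. length xs = 2 \<and> distinct xs)"
proof
  assume "finite_digraph A S"
  then show "finite A \<and> S \<subseteq> lists A \<and> (\<forall>xs\<in>S. length xs = 2 \<and> distinct xs)"
    by (auto simp: finite_digraph_def pairs_def irrefl_def)
next
  assume *: "finite A \<and> S \<subseteq> lists A \<and> (\<forall>xs\<in>S. length xs = 2 \<and> distinct xs)"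
  then obtain E where E: "E \<subseteq> A \<times> A" "S = pairs E"
    using pairs_of_binary[of S A] by blast
  have "(x, x) \<notin> E" for x
  proof
    assume "(x, x) \<in> E"
    then have "[x, x] \<in> S" using E(2) by simp
    then have "distinct [x, x]" using * by blast
    then show False by simp
  qed
  then have "irrefl E" by (simp add: irrefl_def)
  then show "finite_digraph A S" using * E unfolding finite_digraph_def by blast
qed

lemma finite_tournamentD:
  assumes "finite_tournament A S"
  shows "xs \<in> S \<Longrightarrow> length xs = 2"
    and "[x, y] \<in> S \<Longrightarrow> [y, x] \<notin> S"
    and "x \<in> A \<Longrightarrow> y \<in> A \<Longrightarrow> x \<noteq> y \<Longrightarrow> [x, y] \<in> S \<or> [y, x] \<in> S"
proof -
  obtain E where E: "asym E" "total_on A E" "S = pairs E"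
    using assms unfolding finite_tournament_def by blast
  show "length xs = 2" if "xs \<in> S" using that by (auto simp: E(3) pairs_def)
  show "[y, x] \<notin> S" if "[x, y] \<in> S" using that asymD[OF E(1)] by (simp add: E(3))
  show "[x, y] \<in> S \<or> [y, x] \<in> S" if "x \<in> A" "y \<in> A" "x \<noteq> y"
    using that E(2) by (simp add: E(3) total_on_def)
qed

lemma finite_tournamentI:
  assumes "finite A" and lists: "S \<subseteq> lists A" "\<forall>xs\<in>S. length xs = 2"
    and asym: "\<And>x y. [x, y] \<in> S \<Longrightarrow> [y, x] \<notin> S"
    and total: "\<And>x y. x \<in> A \<Longrightarrow> y \<in> A \<Longrightarrow> x \<noteq> y \<Longrightarrow> [x, y] \<in> S \<or> [y, x] \<in> S"
  shows "finite_tournament A S"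
proof -
  obtain E where E: "E \<subseteq> A \<times> A" "S = pairs E" using pairs_of_binary[OF lists] .
  have mem: "[x, y] \<in> S \<longleftrightarrow> (x, y) \<in> E" for x y by (simp add: E(2))
  have "asym E" using asym unfolding mem by (rule asymI)
  moreover have "total_on A E" using total unfolding mem by (intro total_onI)
  ultimately show ?thesis using assms(1) E unfolding finite_tournament_def by blast
qed

text \<open>
  Without tuples across the two copies, every condition that concerns one tuple at a time, or one
  tuple and its permutations, is inherited from \<open>R\<close>. With \<open>symmetric\<close> the class consists of the
  \<open>k\<close>-uniform hypergraphs, which are the graphs for \<open>k = 2\<close>; without it and with \<open>k = 2\<close>, of the
  directed graphs.
\<close>

lemma free_self_amalgam:
  fixes R :: "'a::{countable,infinite} list set"
  assumes lim: "fraisse_limit K UNIV R"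
    and K: "\<And>A S :: 'a list set. K A S \<longleftrightarrow> finite A \<and> S \<subseteq> lists A \<and>
      (\<forall>xs\<in>S. length xs = k \<and> distinct xs) \<and>
      (symmetric \<longrightarrow> (\<forall>xs\<in>S. \<forall>ys. mset ys = mset xs \<longrightarrow> ys \<in> S))"
  shows "\<exists>p\<in>self_embeddings R. \<exists>q\<in>self_embeddings R.
    (\<forall>x\<in>C. p x = q x) \<and> p ` (- C) \<inter> q ` (- C) = {}"
proof (rule self_amalgam[OF lim])
  have R: "length xs = k" "distinct xs" "symmetric \<Longrightarrow> mset ys = mset xs \<Longrightarrow> ys \<in> R"
    if "xs \<in> R" for xs ys
  proof -
    have "xs \<in> induced R (set xs)" using that by simp
    then show "length xs = k" "distinct xs" "symmetric \<Longrightarrow> mset ys = mset xs \<Longrightarrow> ys \<in> R"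
      using finite_part[OF lim, of xs] unfolding K by (blast, blast, metis mem_induced)
  qed
  fix i j :: "'a \<Rightarrow> 'a" assume inj: "inj i" "inj j"
  have copy: "length zs = k \<and> distinct zs \<and> (symmetric \<longrightarrow> (\<forall>ys. mset ys = mset zs \<longrightarrow> ys \<in> map f ` R))"
    if zs: "zs \<in> map f ` R" and f: "inj f" for f :: "'a \<Rightarrow> 'a" and zs
  proof -
    obtain xs where xs: "xs \<in> R" "zs = map f xs" using zs by blast
    have "ys \<in> map f ` R" if "symmetric" and ys: "mset ys = mset zs" for ys
    proof -
      have "set ys \<subseteq> range f" using mset_eq_setD[OF ys] xs(2) by auto
      then have ys_eq: "map f (map (inv f) ys) = ys"
        unfolding map_map by (intro map_idI) (auto simp: f_inv_into_f)
      have "mset (map (inv f) ys) = image_mset (inv f) (image_mset f (mset xs))"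
        using ys xs(2) by simp
      also have "\<dots> = mset xs" using f by (simp add: multiset.map_comp)
      finally have "mset (map (inv f) ys) = mset xs" .
      then have "map (inv f) ys \<in> R" using R(3) xs(1) that(1) by blast
      then show ?thesis using ys_eq by (metis imageI)
    qed
    then show ?thesis using R(1,2)[OF xs(1)] xs(2) inj_on_subset[OF f subset_UNIV, of "set xs"]
      by (simp add: distinct_map)
  qed
  let ?S = "map i ` R \<union> map j ` R \<union> {}"
  have S: "length zs = k \<and> distinct zs \<and> (symmetric \<longrightarrow> (\<forall>ys. mset ys = mset zs \<longrightarrow> ys \<in> ?S))"
    if "zs \<in> ?S" for zs
    using that copy[OF _ inj(1), of zs] copy[OF _ inj(2), of zs] by blast
  have "K X (induced ?S X)" if "finite X" for X
    unfolding K
  proof (intro conjI ballI allI impI)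
    fix zs ys assume "symmetric" "zs \<in> induced ?S X" "mset ys = mset zs"
    then show "ys \<in> induced ?S X" using S[of zs] mset_eq_setD[of ys zs] by (metis mem_induced)
  qed (use that S in \<open>auto simp only: induced_def\<close>)
  then show "\<exists>E. (\<forall>zs\<in>E. \<not> set zs \<subseteq> range i \<and> \<not> set zs \<subseteq> range j) \<and>
        (\<forall>X. finite X \<longrightarrow> X \<subseteq> range i \<union> range j \<longrightarrow>
          K X (induced (map i ` R \<union> map j ` R \<union> E) X))"
    by (intro exI[of _ "{}"]) blast
qed

text \<open>
  A tournament needs an arc between any two points: every point of the first copy outside \<open>C\<close> beats
  every such point of the second copy. Points of \<open>C\<close> belong to both copies and are already comparable
  with everything.
\<close>

lemma tournament_self_amalgam:
  fixes R :: "'a::{countable,infinite} list set"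
  assumes lim: "fraisse_limit finite_tournament UNIV R"
  shows "\<exists>p\<in>self_embeddings R. \<exists>q\<in>self_embeddings R.
    (\<forall>x\<in>C. p x = q x) \<and> p ` (- C) \<inter> q ` (- C) = {}"
proof (rule self_amalgam[OF lim])
  have R_pair: "length xs = 2" if "xs \<in> R" for xs
    using finite_tournamentD(1)[OF finite_part[OF lim], of xs xs] that by simp
  have tour: "finite_tournament {x, y} (induced R {x, y})" for x y
    using finite_part[OF lim, of "[x, y]"] by simp
  have R_asym: "[y, x] \<notin> R" if "[x, y] \<in> R" for x y
    using finite_tournamentD(2)[OF tour[of x y], of x y] that by simp
  have R_total: "[x, y] \<in> R \<or> [y, x] \<in> R" if "x \<noteq> y" for x y
    using finite_tournamentD(3)[OF tour[of x y], of x y] that by simp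
  fix i j :: "'a \<Rightarrow> 'a"
  assume inj: "inj i" "inj j" and ij: "\<And>x y. i x = j y \<longleftrightarrow> x = y \<and> x \<in> C"
  have i_eq [simp]: "i x = i y \<longleftrightarrow> x = y" and j_eq [simp]: "j x = j y \<longleftrightarrow> x = y"
    and ji [simp]: "j y = i x \<longleftrightarrow> x = y \<and> x \<in> C" for x y
    using inj ij[of x y] by (auto simp: inj_eq)
  define E where "E = {[i x, j y] | x y. x \<notin> C \<and> y \<notin> C}"
  let ?S = "map i ` R \<union> map j ` R \<union> E"
  have S_cases: "(\<exists>x y. u = i x \<and> v = i y \<and> [x, y] \<in> R) \<or> (\<exists>x y. u = j x \<and> v = j y \<and> [x, y] \<in> R) \<or>
      (\<exists>x y. u = i x \<and> v = j y \<and> x \<notin> C \<and> y \<notin> C)" if "[u, v] \<in> ?S" for u v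
    using that by (auto simp: E_def Cons_eq_map_conv)
  have S_i: "[i x, i y] \<in> ?S" if "[x, y] \<in> R" for x y
    using imageI[OF that, of "map i"] by simp
  have S_j: "[j x, j y] \<in> ?S" if "[x, y] \<in> R" for x y
    using imageI[OF that, of "map j"] by simp
  have S_pair: "length zs = 2" if "zs \<in> ?S" for zs
    using that R_pair by (auto simp: E_def)
  have S_asym: "[v, u] \<notin> ?S" if "[u, v] \<in> ?S" for u v
  proof
    assume "[v, u] \<in> ?S"
    from S_cases[OF that] S_cases[OF this] show False
      by (elim disjE exE conjE) (auto simp: ij dest: R_asym)
  qed
  have S_total: "[u, v] \<in> ?S \<or> [v, u] \<in> ?S"
    if uv: "u \<in> range i \<union> range j" "v \<in> range i \<union> range j" "u \<noteq> v" for u v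
  proof -
    have total_i: "[i x, i y] \<in> ?S \<or> [i y, i x] \<in> ?S" if "x \<noteq> y" for x y
      using R_total[OF that] S_i by blast
    have total_j: "[j x, j y] \<in> ?S \<or> [j y, j x] \<in> ?S" if "x \<noteq> y" for x y
      using R_total[OF that] S_j by blast
    have total_ij: "[i x, j y] \<in> ?S \<or> [j y, i x] \<in> ?S" if "i x \<noteq> j y" for x y
    proof (cases "x \<in> C \<or> y \<in> C")
      case True
      then have "i x = j x \<or> j y = i y" by (auto simp: ij)
      moreover have "x \<noteq> y" using True that by (auto simp: ij)
      ultimately show ?thesis using total_i[of x y] total_j[of x y] by metis
    next
      case False
      then have "[i x, j y] \<in> E" unfolding E_def by blast
      then show ?thesis by blast
    qed
    show ?thesis using uv(1,2)
    proof (elim UnE rangeE)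
      fix x y assume eq: "u = i x" "v = i y"
      show ?thesis unfolding eq by (rule total_i) (use eq uv(3) in blast)
    next
      fix x y assume eq: "u = i x" "v = j y"
      show ?thesis unfolding eq by (rule total_ij) (use eq uv(3) in blast)
    next
      fix x y assume eq: "u = j y" "v = i x"
      show ?thesis unfolding eq by (rule disj_commute[THEN iffD1, OF total_ij]) (use eq uv(3) in metis)
    next
      fix x y assume eq: "u = j x" "v = j y"
      show ?thesis unfolding eq by (rule total_j) (use eq uv(3) in blast)
    qed
  qed
  show "\<exists>E. (\<forall>zs\<in>E. \<not> set zs \<subseteq> range i \<and> \<not> set zs \<subseteq> range j) \<and>
        (\<forall>X. finite X \<longrightarrow> X \<subseteq> range i \<union> range j \<longrightarrow>
          finite_tournament X (induced (map i ` R \<union> map j ` R \<union> E) X))"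
  proof (intro exI[of _ E] conjI ballI allI impI)
    fix zs assume "zs \<in> E"
    then obtain x y where zs: "zs = [i x, j y]" "x \<notin> C" "y \<notin> C" by (auto simp: E_def)
    have "j y \<notin> range i" "i x \<notin> range j" using zs(2,3) ij by auto
    then show "\<not> set zs \<subseteq> range i" "\<not> set zs \<subseteq> range j" using zs(1) by auto
  next
    fix X assume X: "finite X" "X \<subseteq> range i \<union> range j"
    show "finite_tournament X (induced ?S X)"
    proof (rule finite_tournamentI)
      show "induced ?S X \<subseteq> lists X" by (simp add: induced_def)
      show "\<forall>zs\<in>induced ?S X. length zs = 2"
        using S_pair by (intro ballI) (simp only: mem_induced)
      show "[v, u] \<notin> induced ?S X" if "[u, v] \<in> induced ?S X" for u v
        using S_asym[of u v] that by (metis mem_induced)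
      show "[u, v] \<in> induced ?S X \<or> [v, u] \<in> induced ?S X" if "u \<in> X" "v \<in> X" "u \<noteq> v" for u v
      proof -
        have "[u, v] \<in> ?S \<or> [v, u] \<in> ?S" using that X(2) by (intro S_total) auto
        then show ?thesis using that unfolding mem_induced by simp
      qed
    qed (rule X(1))
  qed
qed

section \<open>Automatic homeomorphicity\<close>

lemma self_embeddings_equality: "self_embeddings (pairs Id) = {f. inj f}"
proof -
  have "map f xs \<in> pairs Id \<longleftrightarrow> xs \<in> pairs Id" if "inj f" for f :: "'a \<Rightarrow> 'b" and xs
    using inj_eq[OF that] by (auto simp: pairs_def map_eq_Cons_conv)
  then show ?thesis by (auto simp: self_embeddings_def embedding_def)
qed

text \<open>
  The complements of finite sets are countably infinite, so a bijection between finite sets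
  extends to a permutation.
\<close>

lemma homogeneous_equality:
  "homogeneous (UNIV :: 'a::{countable,infinite} set) (pairs Id)"
  unfolding homogeneous_def
proof (intro allI impI)
  fix X Y :: "'a set" and f
  assume "finite X" "isomorphism X (induced (pairs Id) X) Y (induced (pairs Id) Y) f"
  then have f: "bij_betw f X Y" and fin: "finite X" "finite Y"
    by (auto simp: isomorphism_def embedding_def bij_betw_def)
  have "infinite (- X)" "infinite (- Y)"
    using fin infinite_UNIV by (simp_all add: Compl_eq_Diff_UNIV)
  then have "bij_betw (from_nat_into (- Y) \<circ> to_nat_on (- X)) (- X) (- Y)"
    by (intro bij_betw_trans[OF to_nat_on_infinite bij_betw_from_nat_into]) auto
  then have "bij (\<lambda>x. if x \<in> X then f x else (from_nat_into (- Y) \<circ> to_nat_on (- X)) x)"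
    using bij_betw_disjoint_Un[OF f, of _ "- X" "- Y"] by simp
  then obtain g where g: "bij g" "\<forall>x\<in>X. g x = f x" by fastforce
  then have "g \<in> self_embeddings (pairs Id)" by (simp add: self_embeddings_equality bij_def)
  then show "\<exists>g. isomorphism UNIV (pairs Id) UNIV (pairs Id) g \<and> (\<forall>x\<in>X. g x = f x)"
    using g by (auto simp: isomorphism_def self_embeddings_def bij_def)
qed

lemma equality_self_amalgam:
  fixes C :: "'a::{countable,infinite} set"
  shows "\<exists>p\<in>self_embeddings (pairs Id). \<exists>q\<in>self_embeddings (pairs Id).
    (\<forall>x\<in>C. p x = q x) \<and> p ` (- C) \<inter> q ` (- C) = {}"
proof -
  obtain i j :: "'a \<Rightarrow> 'a" where "inj i" "inj j" "\<And>x y. i x = j y \<longleftrightarrow> x = y \<and> x \<in> C"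
    using two_copies[of C] by blast
  then show ?thesis
    unfolding self_embeddings_equality by (intro bexI[of _ i] bexI[of _ j]) auto
qed

theorem automatic_homeomorphicity_self_embeddings:
  fixes R :: "'a::{countable,infinite} list set"
  assumes "homogeneous UNIV R"
    and "\<And>C. \<exists>p\<in>self_embeddings R. \<exists>q\<in>self_embeddings R.
      (\<forall>x\<in>C. p x = q x) \<and> p ` (- C) \<inter> q ` (- C) = {}"
  shows "automatic_homeomorphicity (self_embeddings R)"
proof -
  interpret amalgamating_monoid "self_embeddings R"
    using assms by (rule amalgamating_self_embeddings)
  show ?thesis
    unfolding automatic_homeomorphicity_def
    using closed automatically_homeomorphic by blast
qed

lemma fraisse_limit_homogeneous: "fraisse_limit K A R \<Longrightarrow> homogeneous A R"
  by (simp add: fraisse_limit_def)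

theorem corollary22:
  shows "automatic_homeomorphicity
           (self_embeddings (pairs Id) :: ('a::{countable,infinite} \<Rightarrow> 'a) set) \<and>
         (\<forall>R :: 'a list set. fraisse_limit finite_tournament UNIV R \<longrightarrow>
           automatic_homeomorphicity (self_embeddings R)) \<and>
         (\<forall>R :: 'a list set. fraisse_limit finite_graph UNIV R \<longrightarrow>
           automatic_homeomorphicity (self_embeddings R)) \<and>
         (\<forall>R :: 'a list set. fraisse_limit finite_digraph UNIV R \<longrightarrow>
           automatic_homeomorphicity (self_embeddings R)) \<and>
         (\<forall>k \<ge> 2. \<forall>R :: 'a list set. fraisse_limit (finite_hypergraph k) UNIV R \<longrightarrow>
           automatic_homeomorphicity (self_embeddings R))"
proof (intro conjI allI impI)
  show "automatic_homeomorphicity (self_embeddings (pairs Id) :: ('a \<Rightarrow> 'a) set)"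
    by (intro automatic_homeomorphicity_self_embeddings homogeneous_equality equality_self_amalgam)
next
  fix R :: "'a list set" assume lim: "fraisse_limit finite_tournament UNIV R"
  show "automatic_homeomorphicity (self_embeddings R)"
    using fraisse_limit_homogeneous[OF lim] tournament_self_amalgam[OF lim]
    by (rule automatic_homeomorphicity_self_embeddings)
next
  fix R :: "'a list set" assume lim: "fraisse_limit finite_graph UNIV R"
  show "automatic_homeomorphicity (self_embeddings R)"
    using fraisse_limit_homogeneous[OF lim] free_self_amalgam[OF lim, where k = 2 and symmetric = True]
    by (rule automatic_homeomorphicity_self_embeddings)
      (simp add: finite_graph_iff finite_hypergraph_def)
next
  fix R :: "'a list set" assume lim: "fraisse_limit finite_digraph UNIV R"
  show "automatic_homeomorphicity (self_embeddings R)"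
    using fraisse_limit_homogeneous[OF lim] free_self_amalgam[OF lim, where k = 2 and symmetric = False]
    by (rule automatic_homeomorphicity_self_embeddings) (simp add: finite_digraph_iff)
next
  fix k :: nat and R :: "'a list set"
  assume lim: "fraisse_limit (finite_hypergraph k) UNIV R"
  show "automatic_homeomorphicity (self_embeddings R)"
    using fraisse_limit_homogeneous[OF lim] free_self_amalgam[OF lim, where k = k and symmetric = True]
    by (rule automatic_homeomorphicity_self_embeddings) (simp add: finite_hypergraph_def)
qed

end
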